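(* Let $\mathbf f_*\in PW_\omega(\mathcal G)$ be a time-invariant true signal and let the sampling set $\mathcal S$ be a uniqueness set for $PW_\omega(\mathcal G)$. Let $\mu_1,\beta_1>0$ and consider the DLSR iterates $\mathbf f^{(k)}$ (defined in the context) with diminishing stepsize $\mu_k=\mu_1/\sqrt{k}$ and decay factor $\beta_k=\beta_1/\sqrt[4]{k}$, $k\ge1$. Then there is a constant $K$ (independent of $k$) such that $$\|\mathbf f^{(k)}-\mathbf f_*\|\le \frac{K}{\sqrt[4]{k}}\qquad\text{for all } k\ge1 .$$ In particular the total estimation error converges to zero as $k\to\infty$.
   Context: Setting. $\mathcal G$ is an undirected connected graph with vertex set $\mathcal V$, $|\mathcal V|=N$, and normalized Laplacian $\mathcal L=\mathbf D^{-1/2}(\mathbf D-\mathbf A_{\mathcal G})\mathbf D^{-1/2}$ ($\mathbf A_{\mathcal G}$ adjacency matrix, $\mathbf D$ diagonal degree matrix). A graph signal is $\mathbf f\in\mathbb R^N$, with entries $f(v)$, $v\in\mathcal V$; $\|\cdot\|$ is the Euclidean norm. For $\omega\ge0$, $PW_\omega(\mathcal G)$ is the span of the eigenvectors of $\mathcal L$ with eigenvalue $\le\omega$; $\mathcal P_\omega$ is the orthogonal projection onto $PW_\omega(\mathcal G)$. $\bm\delta_u$ is the indicator vector of vertex $u$. A set $\mathcal S\subseteq\mathcal V$ is a uniqueness set for $PW_\omega(\mathcal G)$ if any two elements of $PW_\omega(\mathcal G)$ agreeing on $\mathcal S$ are equal. Delays: $\tau(u,v)$ ($u\in\mathcal S$,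 $v\in\mathcal V$) are nonnegative integers with $\tau(u,u)=0$ (fixed in time). DLSR iteration (time-invariant signal): $\mathbf f^{(0)}=\mathbf 0$, and for $k\ge0$, $v\in\mathcal V$, $$f^{(k+1)}(v)=(1-\mu_{k+1}\beta_{k+1})f^{(k)}(v)+\mu_{k+1}\sum_{u\in\mathcal S}\epsilon^{(k-\tau(u,v))}(u)\,(\mathcal P_\omega\bm\delta_u)(v),$$ where $\epsilon^{(j)}(u)=f_*(u)-f^{(j)}(u)$ for $j\ge0$ and $\epsilon^{(j)}(u)=0$ for $j<0$. *)

theory Defs
  imports "HOL-Analysis.Analysis" "Graph_Theory.Graph_Theory"
begin

text \<open>
  A graph signal is a vector in \<open>real ^ 'n\<close>, indexed by the vertex type \<open>'n\<close>. An undirected edge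
  is a pair of opposite arcs, so that the out-degree of a vertex is its number of neighbours.
\<close>

definition adjacency_matrix :: "('n::finite, 'e) pre_digraph \<Rightarrow> real ^ 'n ^ 'n" where
  "adjacency_matrix G = (\<chi> u v. if (u, v) \<in> arcs_ends G then 1 else 0)"

definition degree_matrix :: "('n::finite, 'e) pre_digraph \<Rightarrow> real ^ 'n ^ 'n" where
  "degree_matrix G = (\<chi> u v. if u = v then real (out_degree G u) else 0)"

text \<open>
  The matrix \<open>D\<^sup>-\<^sup>1\<^sup>/\<^sup>2\<close>. Since \<open>0 powr a = 0\<close>, the entry of an isolated vertex is \<open>0\<close>, the usual
  convention for the normalized Laplacian. In a connected simple graph this arises only for the
  one-vertex graph.
\<close>
definition degree_matrix_inv_sqrt :: "('n::finite, 'e) pre_digraph \<Rightarrow> real ^ 'n ^ 'n" where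
  "degree_matrix_inv_sqrt G =
     (\<chi> u v. if u = v then real (out_degree G u) powr (- 1 / 2) else 0)"

definition normalized_laplacian :: "('n::finite, 'e) pre_digraph \<Rightarrow> real ^ 'n ^ 'n" where
  "normalized_laplacian G =
     degree_matrix_inv_sqrt G ** (degree_matrix G - adjacency_matrix G) ** degree_matrix_inv_sqrt G"

definition paley_wiener :: "('n::finite, 'e) pre_digraph \<Rightarrow> real \<Rightarrow> (real ^ 'n) set" where
  "paley_wiener G \<omega> =
     span {x. x \<noteq> 0 \<and> (\<exists>c\<le>\<omega>. normalized_laplacian G *v x = c *\<^sub>R x)}"

definition orthogonal_projection :: "'a::euclidean_space set \<Rightarrow> 'a \<Rightarrow> 'a" where
  "orthogonal_projection U x = (THE y. y \<in> U \<and> (\<forall>z\<in>U. orthogonal (x - y) z))"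

lemma orthogonal_projection:
  fixes U :: "'a::euclidean_space set"
  assumes "subspace U"
  shows "orthogonal_projection U x \<in> U"
    and "z \<in> U \<Longrightarrow> orthogonal (x - orthogonal_projection U x) z"
proof -
  have "\<exists>!y. y \<in> U \<and> (\<forall>z\<in>U. orthogonal (x - y) z)"
  proof (rule ex_ex1I)
    obtain y w where "y \<in> span U" "\<And>v. v \<in> span U \<Longrightarrow> orthogonal w v" "x = y + w"
      using orthogonal_subspace_decomp_exists [of U x] by metis
    then show "\<exists>y. y \<in> U \<and> (\<forall>z\<in>U. orthogonal (x - y) z)"
      using assms by (metis add_diff_cancel_left' span_eq_iff)
  next
    fix y y'
    assume *: "y \<in> U \<and> (\<forall>z\<in>U. orthogonal (x - y) z)" "y' \<in> U \<and> (\<forall>z\<in>U. orthogonal (x - y') z)"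
    then have "y - y' \<in> U"
      using assms by (simp add: subspace_diff)
    with * have "inner (x - y') (y - y') - inner (x - y) (y - y') = 0"
      by (simp add: orthogonal_def)
    then have "inner (y - y') (y - y') = 0"
      by (simp add: inner_diff_left)
    then show "y = y'"
      by simp
  qed
  from theI' [OF this]
  show "orthogonal_projection U x \<in> U"
    and "z \<in> U \<Longrightarrow> orthogonal (x - orthogonal_projection U x) z"
    unfolding orthogonal_projection_def by blast+
qed

definition uniqueness_set :: "'n::finite set \<Rightarrow> (real ^ 'n) set \<Rightarrow> bool" where
  "uniqueness_set S U \<longleftrightarrow> (\<forall>f\<in>U. \<forall>g\<in>U. (\<forall>v\<in>S. f $ v = g $ v) \<longrightarrow> f = g)"

text \<open>
  The DLSR iterates for the true signal \<open>fs\<close>, with delays \<open>\<tau>\<close>, stepsizes \<open>\<mu>\<close> and decay factors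
  \<open>\<beta>\<close>. The conditional is the delayed error at time \<open>k - \<tau> u v\<close>, which is zero at negative times.
\<close>
fun dlsr :: "('n::finite, 'e) pre_digraph \<Rightarrow> real \<Rightarrow> 'n set \<Rightarrow> ('n \<Rightarrow> 'n \<Rightarrow> nat) \<Rightarrow>
    (nat \<Rightarrow> real) \<Rightarrow> (nat \<Rightarrow> real) \<Rightarrow> real ^ 'n \<Rightarrow> nat \<Rightarrow> real ^ 'n" where
  "dlsr G \<omega> S \<tau> \<mu> \<beta> fs 0 = 0"
| "dlsr G \<omega> S \<tau> \<mu> \<beta> fs (Suc k) =
     (\<chi> v. (1 - \<mu> (Suc k) * \<beta> (Suc k)) * dlsr G \<omega> S \<tau> \<mu> \<beta> fs k $ v
        + \<mu> (Suc k) * (\<Sum>u\<in>S.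
            (if \<tau> u v \<le> k then fs $ u - dlsr G \<omega> S \<tau> \<mu> \<beta> fs (k - \<tau> u v) $ u else 0)
            * orthogonal_projection (paley_wiener G \<omega>) (axis u 1) $ v))"

end

theory Submission
  imports Defs "HOL-Real_Asymp.Real_Asymp"
begin

text \<open>
  Write \<open>e\<close> for the error, \<open>P\<close> for the projection onto the Paley--Wiener space and \<open>r k = (k + 1)\<^sup>-\<^sup>1\<^sup>/\<^sup>4\<close>,
  so that the stepsize is of order \<open>r\<^sup>2\<close> and the decay factor of order \<open>r\<close>. Delays matter only through
  the drift of the iterates over a bounded time window, which for bounded errors is \<open>O(r\<^sup>2)\<close>. Because of
  the delays the iterates leave the Paley--Wiener space, and the two parts of the error behave
  differently. On the part \<open>P e\<close> the sampling operator is coercive (uniqueness set), so it contracts at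
  rate \<open>r\<^sup>2\<close> and is driven by \<open>r\<^sup>3\<close> from the decay term and by \<open>r\<^sup>2 \<parallel>e - P e\<parallel>\<close>. The part \<open>e - P e\<close> is
  damped only by the decay factor, at rate \<open>r\<^sup>3\<close>, but is driven only by the delays, at order \<open>r\<^sup>4\<close>.
  In both cases the quotient of forcing by damping is \<open>O(r)\<close>.
\<close>

section \<open>Scalar recursions with damping and forcing\<close>

text \<open>The sequence \<open>K * r\<close> is a supersolution once
  \<open>K \<ge> 2 * \<bar>D\<bar>\<close>: half of the damping \<open>s k\<close> absorbs the
  forcing, and the other half covers the decrease of \<open>r\<close> in one step, which
  \<open>slow\<close> limits.\<close>

lemma contraction_with_forcing_rate:
  fixes x s r :: "nat \<Rightarrow> real"
  assumes r: "\<And>k. 0 < r k"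
    and s: "\<forall>\<^sub>F k in sequentially. 0 \<le> s k \<and> s k \<le> 1"
    and step: "\<forall>\<^sub>F k in sequentially. x (Suc k) \<le> (1 - s k) * x k + s k * (D * r k)"
    and slow: "\<forall>\<^sub>F k in sequentially. (1 - s k / 2) * r k \<le> r (Suc k)"
  shows "\<exists>K. \<forall>k. x k \<le> K * r k"
proof -
  obtain k0 where k0: "0 \<le> s k" "s k \<le> 1" "x (Suc k) \<le> (1 - s k) * x k + s k * (D * r k)"
    "(1 - s k / 2) * r k \<le> r (Suc k)" if "k \<ge> k0" for k
    using eventually_conj[OF s eventually_conj[OF step slow]]
    by (auto simp: eventually_sequentially)
  \<comment> \<open>The first entry makes the induction step work and gives
    \<open>K \<ge> 0\<close>; the others cover the initial segment, where the eventual hypotheses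
    may fail.\<close>
  define K where "K = Max (insert (2 * \<bar>D\<bar>) ((\<lambda>k. x k / r k) ` {..k0}))"
  have KD: "2 * \<bar>D\<bar> \<le> K" and Kx: "x k / r k \<le> K" if "k \<le> k0" for k
    unfolding K_def using that by (auto intro!: Max_ge simp del: Max_insert)
  have small: "x k \<le> K * r k" if "k \<le> k0" for k
    using Kx[OF that] r[of k] by (simp add: divide_le_eq)
  have "x k \<le> K * r k" if "k \<ge> k0" for k
    using that
  proof (induction k rule: dec_induct)
    case base
    show ?case using small by simp
  next
    case (step k)
    have "x (Suc k) \<le> (1 - s k) * x k + s k * (D * r k)"
      using k0 step by simp
    also have "\<dots> \<le> (1 - s k) * (K * r k) + s k * (K / 2 * r k)"
      using k0[OF step(1)] step r[of k] KD[of 0]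
      by (intro add_mono mult_left_mono mult_right_mono) auto
    also have "\<dots> = K * ((1 - s k / 2) * r k)"
      by (simp add: algebra_simps)
    also have "\<dots> \<le> K * r (Suc k)"
      using k0[OF step(1)] KD[of 0] by (intro mult_left_mono) auto
    finally show ?case .
  qed
  with small show ?thesis
    by (metis nle_le)
qed

text \<open>Delayed values make the forcing depend on the whole past, so the hypotheses are stated
  for every bound \<open>B\<close> on the history. No such bound is known in advance; it comes from
  an invariant region, because the history enters one order in \<open>r\<close> below the weaker of
  the two dampings.\<close>

lemma coupled_recursion_bounded:
  fixes a b r :: "nat \<Rightarrow> real"
  assumes nonneg: "\<And>k. 0 \<le> a k" "\<And>k. 0 \<le> b k"
    and r: "\<And>k. 0 < r k" "r \<longlonglongrightarrow> 0"
    and pos: "0 < \<mu>" "0 < \<beta>" "0 < c" and nn: "0 \<le> C" "0 \<le> L" "0 \<le> F"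
    and a: "\<forall>\<^sub>F k in sequentially. \<forall>B. (\<forall>j\<le>k. a j + b j \<le> B) \<longrightarrow>
      a (Suc k) \<le> (1 - \<mu> * \<beta> * r k ^ 3) * a k + \<mu> * r k ^ 2 * (C * r k ^ 2 * (B + F))"
    and b: "\<forall>\<^sub>F k in sequentially. \<forall>B. (\<forall>j\<le>k. a j + b j \<le> B) \<longrightarrow>
      b (Suc k) \<le> (1 - c * \<mu> * r k ^ 2) * b k +
        \<mu> * r k ^ 2 * (\<beta> * r k * F + L * a k + C * r k ^ 2 * (B + F))"
  shows "\<exists>B\<ge>0. \<forall>k. a k + b k \<le> B"
proof -
  \<comment> \<open>With \<open>c * \<kappa> \<ge> L + 3\<close>, the damping of \<open>b\<close> at
    level \<open>\<kappa> * t\<close> dominates the coupling, at most \<open>L * t\<close>, and the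
    other two forcing terms, at most \<open>t\<close> each.\<close>
  define \<kappa> where "\<kappa> = 1 + (L + 3) / c"
  have \<kappa>: "1 \<le> \<kappa>" "L + 3 \<le> c * \<kappa>"
    using pos nn by (simp_all add: \<kappa>_def field_simps)
  have lim: "(\<lambda>k. C * (2 + \<kappa>) * r k) \<longlonglongrightarrow> 0" "(\<lambda>k. \<beta> * r k) \<longlonglongrightarrow> 0"
     "(\<lambda>k. c * \<mu> * r k ^ 2) \<longlonglongrightarrow> 0" "(\<lambda>k. \<mu> * \<beta> * r k ^ 3) \<longlonglongrightarrow> 0"
    using r(2) by (auto intro!: tendsto_eq_intros)
  have small: "\<forall>\<^sub>F k in sequentially. C * (2 + \<kappa>) * r k < \<beta> \<and> \<beta> * r k < 1 \<and>
      c * \<mu> * r k ^ 2 < 1 \<and> \<mu> * \<beta> * r k ^ 3 < 1"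
    using pos by (intro eventually_conj order_tendstoD(2)[OF lim(1)] order_tendstoD(2)[OF lim(2)]
       order_tendstoD(2)[OF lim(3)] order_tendstoD(2)[OF lim(4)]) auto
  obtain k0 where "\<forall>k\<ge>k0. (C * (2 + \<kappa>) * r k < \<beta> \<and> \<beta> * r k < 1 \<and>
      c * \<mu> * r k ^ 2 < 1 \<and> \<mu> * \<beta> * r k ^ 3 < 1) \<and>
     (\<forall>B. (\<forall>j\<le>k. a j + b j \<le> B) \<longrightarrow>
      a (Suc k) \<le> (1 - \<mu> * \<beta> * r k ^ 3) * a k + \<mu> * r k ^ 2 * (C * r k ^ 2 * (B + F))) \<and>
     (\<forall>B. (\<forall>j\<le>k. a j + b j \<le> B) \<longrightarrow>
      b (Suc k) \<le> (1 - c * \<mu> * r k ^ 2) * b k +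
        \<mu> * r k ^ 2 * (\<beta> * r k * F + L * a k + C * r k ^ 2 * (B + F)))"
    using eventually_conj[OF small eventually_conj[OF a b]]
    unfolding eventually_sequentially by blast
  note k0 = this[rule_format, THEN conjunct1, THEN conjunct1]
     this[rule_format, THEN conjunct1, THEN conjunct2, THEN conjunct1]
     this[rule_format, THEN conjunct1, THEN conjunct2, THEN conjunct2, THEN conjunct1]
     this[rule_format, THEN conjunct1, THEN conjunct2, THEN conjunct2, THEN conjunct2]
     this[rule_format, THEN conjunct2, THEN conjunct1, rule_format]
     this[rule_format, THEN conjunct2, THEN conjunct2, rule_format]
  \<comment> \<open>The scale \<open>t\<close> dominates \<open>F\<close> and all values up to
    \<open>k0\<close>. It is fixed after \<open>k0\<close>, which is possible because the smallness
    conditions defining \<open>k0\<close> involve \<open>\<kappa>\<close> but not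
    \<open>t\<close>.\<close>
  define t where "t = Max (insert F ((\<lambda>k. a k + b k) ` {..k0}))"
  have tF: "F \<le> t" and tx: "a k + b k \<le> t" if "k \<le> k0" for k
    unfolding t_def using that by (auto intro!: Max_ge simp del: Max_insert)
  have t: "0 \<le> t" using nn tF[of 0] by simp
  define B where "B = (1 + \<kappa>) * t"
  have tB: "t \<le> \<kappa> * t" "t \<le> B"
    using \<kappa> t by (auto simp: B_def algebra_simps mult_le_cancel_right1)
  \<comment> \<open>The box \<open>a \<le> t, b \<le> \<kappa> t\<close> is eventually invariant: it is elongated in the direction of \<open>b\<close> so that
    the strong damping of \<open>b\<close> absorbs the coupling term \<open>L a\<close>.\<close>
  have inv: "a k \<le> t \<and> b k \<le> \<kappa> * t \<and> (\<forall>j\<le>k. a j + b j \<le> B)" if "k \<ge> k0" for k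
    using that
  proof (induction k rule: dec_induct)
    case base
    have "a k0 \<le> t" "b k0 \<le> t"
      using tx[of k0] nonneg[of k0] by linarith+
    moreover have "\<forall>j\<le>k0. a j + b j \<le> B"
      using tx tB by force
    ultimately show ?case
      using tB by (meson order_trans)
  next
    case (step k)
    note k = k0[OF step(1)]
    have IH: "a k \<le> t" "b k \<le> \<kappa> * t" "\<forall>j\<le>k. a j + b j \<le> B"
      using step by auto
    \<comment> \<open>Apart from the common factor \<open>\<mu> * r k ^ 2\<close>, the history term
      is of order \<open>r k ^ 2\<close> while \<open>a\<close> is damped at order
      \<open>r k\<close>; the choice of \<open>k0\<close> turns this gain of one order into the
      constant \<open>\<beta>\<close>.\<close>
    have "C * r k ^ 2 * (B + F) \<le> C * r k ^ 2 * ((2 + \<kappa>) * t)"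
      using nn tF[of 0] by (intro mult_left_mono) (auto simp: B_def algebra_simps)
    also have "\<dots> = (C * (2 + \<kappa>) * r k) * (r k * t)"
      by (simp add: power2_eq_square)
    also have "\<dots> \<le> \<beta> * (r k * t)"
      using k(1) r(1)[of k] t by (intro mult_right_mono) auto
    finally have d: "C * r k ^ 2 * (B + F) \<le> \<beta> * r k * t"
      by simp
    have "a (Suc k) \<le> (1 - \<mu> * \<beta> * r k ^ 3) * a k + \<mu> * r k ^ 2 * (C * r k ^ 2 * (B + F))"
      using k(5) IH by blast
    also have "\<dots> \<le> (1 - \<mu> * \<beta> * r k ^ 3) * t + \<mu> * r k ^ 2 * (\<beta> * r k * t)"
      using IH(1) k(4) pos d by (intro add_mono mult_left_mono) auto
    also have "\<dots> = t"
      by (simp add: algebra_simps power2_eq_square power3_eq_cube)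
    finally have a': "a (Suc k) \<le> t" .
    have rt: "\<beta> * r k * t \<le> t"
      using k(2) t by (intro mult_left_le_one_le) (use pos r(1)[of k] in auto)
    have rF: "\<beta> * r k * F \<le> \<beta> * r k * t"
      using pos r(1)[of k] tF[of 0] by (intro mult_left_mono) auto
    have La: "L * a k \<le> L * t"
      using nn IH by (intro mult_left_mono) auto
    have "\<beta> * r k * F + L * a k + C * r k ^ 2 * (B + F) \<le> (L + 3) * t"
      using d rt rF La t by (simp add: algebra_simps)
    also have "\<dots> \<le> c * \<kappa> * t"
      using \<kappa> t by (intro mult_right_mono)
    finally have forcing: "\<beta> * r k * F + L * a k + C * r k ^ 2 * (B + F) \<le> c * \<kappa> * t" .
    have "b (Suc k) \<le> (1 - c * \<mu> * r k ^ 2) * b k +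
        \<mu> * r k ^ 2 * (\<beta> * r k * F + L * a k + C * r k ^ 2 * (B + F))"
      using k(6) IH by blast
    also have "\<dots> \<le> (1 - c * \<mu> * r k ^ 2) * (\<kappa> * t) + \<mu> * r k ^ 2 * (c * \<kappa> * t)"
      using IH(2) k(3) pos forcing by (intro add_mono mult_left_mono) auto
    also have "\<dots> = \<kappa> * t"
      by (simp add: algebra_simps)
    finally have b': "b (Suc k) \<le> \<kappa> * t" .
    have "a (Suc k) + b (Suc k) \<le> B"
      using a' b' by (simp add: B_def algebra_simps)
    with a' b' IH(3) show ?case
      by (auto simp: le_Suc_eq)
  qed
  have "a k + b k \<le> B" for k
    using inv[of "max k k0"] by auto
  moreover have "0 \<le> B"
    using t tB by simp
  ultimately show ?thesis
    by blast
qed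

text \<open>Once the history is bounded by a constant, the system is triangular: the recursion for
  \<open>a\<close> no longer involves \<open>b\<close> and yields \<open>a = O(r)\<close>, and
  inserting this makes the forcing of \<open>b\<close> of order \<open>r ^ 3\<close> against a
  damping of order \<open>r ^ 2\<close>.\<close>

lemma coupled_recursion_rate:
  fixes a b r :: "nat \<Rightarrow> real"
  assumes nonneg: "\<And>k. 0 \<le> a k" "\<And>k. 0 \<le> b k"
    and r: "\<And>k. 0 < r k" "r \<longlonglongrightarrow> 0"
    and slow: "\<And>s. 0 < s \<Longrightarrow> \<forall>\<^sub>F k in sequentially. (1 - s * r k ^ 3) * r k \<le> r (Suc k)"
    and pos: "0 < \<mu>" "0 < \<beta>" "0 < c" and nn: "0 \<le> C" "0 \<le> L" "0 \<le> F"
    and a: "\<forall>\<^sub>F k in sequentially. \<forall>B. (\<forall>j\<le>k. a j + b j \<le> B) \<longrightarrow>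
      a (Suc k) \<le> (1 - \<mu> * \<beta> * r k ^ 3) * a k + \<mu> * r k ^ 2 * (C * r k ^ 2 * (B + F))"
    and b: "\<forall>\<^sub>F k in sequentially. \<forall>B. (\<forall>j\<le>k. a j + b j \<le> B) \<longrightarrow>
      b (Suc k) \<le> (1 - c * \<mu> * r k ^ 2) * b k +
        \<mu> * r k ^ 2 * (\<beta> * r k * F + L * a k + C * r k ^ 2 * (B + F))"
  shows "\<exists>K. \<forall>k. a k + b k \<le> K * r k"
proof -
  obtain B where B: "0 \<le> B" "\<And>k. a k + b k \<le> B"
    using coupled_recursion_bounded[OF nonneg r pos nn a b] by blast
  have lim: "(\<lambda>k. c * \<mu> * r k ^ 2) \<longlonglongrightarrow> 0" "(\<lambda>k. \<mu> * \<beta> * r k ^ 3) \<longlonglongrightarrow> 0"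
    using r(2) by (auto intro!: tendsto_eq_intros)
  have r1: "\<forall>\<^sub>F k in sequentially. r k < 1"
    using order_tendstoD(2)[OF r(2)] by simp
  have "\<exists>K. \<forall>k. a k \<le> K * r k"
  proof (rule contraction_with_forcing_rate[where s = "\<lambda>k. \<mu> * \<beta> * r k ^ 3"])
    show "\<forall>\<^sub>F k in sequentially. 0 \<le> \<mu> * \<beta> * r k ^ 3 \<and> \<mu> * \<beta> * r k ^ 3 \<le> 1"
      using order_tendstoD(2)[OF lim(2), of 1] pos r(1)
      by (auto elim!: eventually_mono intro: less_imp_le)
    show "\<forall>\<^sub>F k in sequentially. (1 - \<mu> * \<beta> * r k ^ 3 / 2) * r k \<le> r (Suc k)"
      using slow[of "\<mu> * \<beta> / 2"] pos by simp
    show "\<forall>\<^sub>F k in sequentially. a (Suc k) \<le> (1 - \<mu> * \<beta> * r k ^ 3) * a k +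
        \<mu> * \<beta> * r k ^ 3 * (C * (B + F) / \<beta> * r k)"
      using a
    proof eventually_elim
      case (elim k)
      have "a (Suc k) \<le> (1 - \<mu> * \<beta> * r k ^ 3) * a k + \<mu> * r k ^ 2 * (C * r k ^ 2 * (B + F))"
        using elim B by blast
      also have "\<mu> * r k ^ 2 * (C * r k ^ 2 * (B + F)) = \<mu> * \<beta> * r k ^ 3 * (C * (B + F) / \<beta> * r k)"
        using pos by (simp add: power2_eq_square power3_eq_cube)
      finally show ?case .
    qed
  qed (use r in auto)
  then obtain A where A: "\<And>k. a k \<le> A * r k"
    by blast
  have "\<exists>K. \<forall>k. b k \<le> K * r k"
  proof (rule contraction_with_forcing_rate[where s = "\<lambda>k. c * \<mu> * r k ^ 2"])
    show "\<forall>\<^sub>F k in sequentially. 0 \<le> c * \<mu> * r k ^ 2 \<and> c * \<mu> * r k ^ 2 \<le> 1"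
      using order_tendstoD(2)[OF lim(1), of 1] pos
      by (auto elim!: eventually_mono intro: less_imp_le)
    have "0 < c * \<mu> / 2"
      using pos by simp
    \<comment> \<open>Since \<open>r k < 1\<close> eventually, a damping of order
      \<open>r k ^ 2\<close> exceeds one of order \<open>r k ^ 3\<close>, for which
      \<open>slow\<close> is assumed.\<close>
    from slow[OF this] r1 show "\<forall>\<^sub>F k in sequentially. (1 - c * \<mu> * r k ^ 2 / 2) * r k \<le> r (Suc k)"
    proof eventually_elim
      case (elim k)
      have "r k ^ 3 \<le> r k ^ 2"
        using elim r(1)[of k] by (intro power_decreasing) auto
      then have "c * \<mu> / 2 * r k ^ 3 \<le> c * \<mu> / 2 * r k ^ 2"
        using pos by (intro mult_left_mono) auto
      then have "(1 - c * \<mu> * r k ^ 2 / 2) * r k \<le> (1 - c * \<mu> / 2 * r k ^ 3) * r k"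
        using r(1)[of k] by (intro mult_right_mono) auto
      with elim show ?case by linarith
    qed
    show "\<forall>\<^sub>F k in sequentially. b (Suc k) \<le> (1 - c * \<mu> * r k ^ 2) * b k +
        c * \<mu> * r k ^ 2 * ((\<beta> * F + L * A + C * (B + F)) / c * r k)"
      using b r1
    proof eventually_elim
      case (elim k)
      have "r k ^ 2 \<le> r k"
        using elim r(1)[of k] by (simp add: power2_eq_square)
      then have "C * (B + F) * r k ^ 2 \<le> C * (B + F) * r k"
        using nn B by (intro mult_left_mono) auto
      moreover have "L * a k \<le> L * (A * r k)"
        using A nn by (intro mult_left_mono)
      ultimately have f: "\<beta> * r k * F + L * a k + C * r k ^ 2 * (B + F)
          \<le> (\<beta> * F + L * A + C * (B + F)) * r k"
        by (simp add: algebra_simps)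
      have "b (Suc k) \<le> (1 - c * \<mu> * r k ^ 2) * b k +
        \<mu> * r k ^ 2 * (\<beta> * r k * F + L * a k + C * r k ^ 2 * (B + F))"
        using elim B by blast
      also have "\<dots> \<le> (1 - c * \<mu> * r k ^ 2) * b k +
        \<mu> * r k ^ 2 * ((\<beta> * F + L * A + C * (B + F)) * r k)"
        using f pos by (intro add_left_mono mult_left_mono) auto
      also have "\<dots> = (1 - c * \<mu> * r k ^ 2) * b k +
          c * \<mu> * r k ^ 2 * ((\<beta> * F + L * A + C * (B + F)) / c * r k)"
        using pos by simp
      finally show ?case .
    qed
  qed (use r in auto)
  then obtain K where "\<And>k. b k \<le> K * r k"
    by blast
  with A have "a k + b k \<le> (A + K) * r k" for k
    by (metis add_mono distrib_right)
  then show ?thesis by blast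
qed

section \<open>Orthogonal projections\<close>

lemma orthogonal_projection_eqI:
  fixes U :: "'a::euclidean_space set"
  assumes "subspace U" "y \<in> U" "\<And>z. z \<in> U \<Longrightarrow> orthogonal (x - y) z"
  shows "orthogonal_projection U x = y"
proof -
  let ?p = "orthogonal_projection U x"
  have "y - ?p \<in> U"
    using assms(1,2) orthogonal_projection(1)[OF assms(1)] by (simp add: subspace_diff)
  then have "inner (x - ?p) (y - ?p) - inner (x - y) (y - ?p) = 0"
    using assms orthogonal_projection(2)[OF assms(1)] by (simp add: orthogonal_def)
  then have "inner (y - ?p) (y - ?p) = 0"
    by (simp flip: inner_diff_left)
  then show ?thesis
    by simp
qed

lemma linear_orthogonal_projection:
  fixes U :: "'a::euclidean_space set"
  assumes U: "subspace U"
  shows "linear (orthogonal_projection U)"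
proof (rule linearI)
  note P = orthogonal_projection[OF U]
  show "orthogonal_projection U (x + y) = orthogonal_projection U x + orthogonal_projection U y" for x y
    using P(2)[of _ x] P(2)[of _ y] P(1)
    by (intro orthogonal_projection_eqI U subspace_add)
       (auto simp: orthogonal_def inner_diff_left inner_add_left)
  show "orthogonal_projection U (c *\<^sub>R x) = c *\<^sub>R orthogonal_projection U x" for c x
    using P(2)[of _ x] P(1)
    by (intro orthogonal_projection_eqI U subspace_scale)
       (auto simp: orthogonal_def inner_diff_left)
qed

lemma orthogonal_projection_ident:
  fixes U :: "'a::euclidean_space set"
  assumes "subspace U" "x \<in> U"
  shows "orthogonal_projection U x = x"
  using assms by (intro orthogonal_projection_eqI) (auto simp: orthogonal_def)

lemma norm_orthogonal_projection_Pythagoras: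
  fixes U :: "'a::euclidean_space set"
  assumes "subspace U"
  shows "norm x ^ 2 = norm (orthogonal_projection U x) ^ 2 + norm (x - orthogonal_projection U x) ^ 2"
  using norm_add_Pythagorean[of "orthogonal_projection U x" "x - orthogonal_projection U x"]
    orthogonal_projection[OF assms] by (simp add: orthogonal_commute)

lemma norm_orthogonal_projection_le:
  fixes U :: "'a::euclidean_space set"
  assumes "subspace U"
  shows "norm (orthogonal_projection U x) \<le> norm x"
    and "norm (x - orthogonal_projection U x) \<le> norm x"
  using norm_orthogonal_projection_Pythagoras[OF assms, of x]
  by (simp_all add: power2_le_imp_le)

section \<open>Perturbed coercive iterations\<close>

text \<open>Expanding the square bounds the squared contraction factor by
  \<open>1 - 2 * c * t + t^2 * L^2\<close>, where \<open>L\<close> bounds \<open>T\<close>. For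
  small \<open>t\<close> this is at most \<open>1 - c * t\<close>, hence at most
  \<open>(1 - c / 2 * t)^2\<close>.\<close>

lemma coercive_gradient_step_contraction:
  fixes T :: "'a::euclidean_space \<Rightarrow> 'a"
  assumes "linear T" and "0 < c" and coercive: "\<And>x. x \<in> U \<Longrightarrow> c * norm x ^ 2 \<le> inner x (T x)"
  shows "\<exists>t0>0. \<forall>t\<in>{0..t0}. \<forall>x\<in>U. norm (x - t *\<^sub>R T x) \<le> (1 - c / 2 * t) * norm x"
proof -
  obtain L where L: "0 < L" "\<And>x. norm (T x) \<le> L * norm x"
    using linear_bounded_pos[OF \<open>linear T\<close>] by blast
  \<comment> \<open>The first bound lets the quadratic term cost at most half of the linear gain;
    the second keeps \<open>1 - c / 2 * t\<close> nonnegative, so that squares can be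
    compared.\<close>
  define t0 where "t0 = min (c / L^2) (2 / c)"
  have "norm (x - t *\<^sub>R T x) \<le> (1 - c / 2 * t) * norm x"
    if t: "t \<in> {0..t0}" and x: "x \<in> U" for t x
  proof (rule power2_le_imp_le)
    have t': "t * L^2 \<le> c" "c / 2 * t \<le> 1"
      using t L \<open>0 < c\<close> by (auto simp: t0_def field_simps)
    have "norm (x - t *\<^sub>R T x) ^ 2 = norm x ^ 2 - 2 * t * inner x (T x) + t^2 * norm (T x) ^ 2"
      unfolding power2_norm_eq_inner
      by (simp add: inner_diff_left inner_diff_right inner_commute algebra_simps power2_eq_square)
    also have "\<dots> \<le> norm x ^ 2 - 2 * t * (c * norm x ^ 2) + t^2 * (L * norm x) ^ 2"
      using t coercive[OF x] L
      by (intro add_mono diff_mono mult_left_mono power_mono) auto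
    also have "\<dots> = (1 - 2 * c * t + t * (t * L^2)) * norm x ^ 2"
      by (simp add: algebra_simps power2_eq_square)
    also have "\<dots> \<le> (1 - 2 * c * t + t * c) * norm x ^ 2"
      using t t' by (intro mult_right_mono add_left_mono mult_left_mono) auto
    also have "\<dots> \<le> (1 - c / 2 * t) ^ 2 * norm x ^ 2"
      using t \<open>0 < c\<close> by (intro mult_right_mono) (auto simp: power2_eq_square algebra_simps)
    finally show "norm (x - t *\<^sub>R T x) ^ 2 \<le> ((1 - c / 2 * t) * norm x) ^ 2"
      by (simp add: power_mult_distrib)
    show "0 \<le> (1 - c / 2 * t) * norm x"
      using t' by simp
  qed
  moreover have "0 < t0"
    using L \<open>0 < c\<close> by (simp add: t0_def)
  ultimately show ?thesis
    by blast
qed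

text \<open>In the application \<open>g\<close> is the true signal, produced by the decay term, and
  \<open>d\<close> is the effect of the delays. Both \<open>g\<close> and the range of
  \<open>T\<close> lie in \<open>U\<close>, so the component of \<open>e\<close> orthogonal to
  \<open>U\<close> sees only \<open>d\<close>, while the component in \<open>U\<close> is contracted
  by \<open>T\<close>. Their norms satisfy the coupled scalar recursions.\<close>

lemma perturbed_coercive_iteration_rate:
  fixes e d :: "nat \<Rightarrow> 'a::euclidean_space" and T :: "'a \<Rightarrow> 'a" and r :: "nat \<Rightarrow> real"
  assumes U: "subspace U" "g \<in> U"
    and T: "linear T" "\<And>x. T x \<in> U"
    and coercive: "0 < c" "\<And>x. x \<in> U \<Longrightarrow> c * norm x ^ 2 \<le> inner x (T x)"
    and r: "\<And>k. 0 < r k" "r \<longlonglongrightarrow> 0"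
    and slow: "\<And>s. 0 < s \<Longrightarrow> \<forall>\<^sub>F k in sequentially. (1 - s * r k ^ 3) * r k \<le> r (Suc k)"
    and pos: "0 < \<mu>" "0 < \<beta>"
    and step: "\<And>k. e (Suc k) = (1 - \<mu> * \<beta> * r k ^ 3) *\<^sub>R e k - (\<mu> * \<beta> * r k ^ 3) *\<^sub>R g
        - (\<mu> * r k ^ 2) *\<^sub>R (T (e k) + d k)"
    and C: "0 \<le> C"
    and d: "\<forall>\<^sub>F k in sequentially. \<forall>B. (\<forall>j\<le>k. norm (e j) \<le> B) \<longrightarrow>
        norm (d k) \<le> C * r k ^ 2 * (B + norm g)"
  shows "\<exists>K. \<forall>k. norm (e k) \<le> K * r k"
proof -
  define P where "P = orthogonal_projection U"
  have P: "linear P" and PU: "P x \<in> U" and Pid: "x \<in> U \<Longrightarrow> P x = x"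
    and Ple: "norm (P x) \<le> norm x" and Qle: "norm (x - P x) \<le> norm x" for x
    using U by (simp_all add: P_def linear_orthogonal_projection orthogonal_projection
        orthogonal_projection_ident norm_orthogonal_projection_le)
  obtain L where L: "0 < L" "\<And>x. norm (T x) \<le> L * norm x"
    using linear_bounded_pos[OF \<open>linear T\<close>] by blast
  obtain t0 where t0: "0 < t0"
      "\<forall>t\<in>{0..t0}. \<forall>x\<in>U. norm (x - t *\<^sub>R T x) \<le> (1 - c / 2 * t) * norm x"
    using coercive_gradient_step_contraction[OF T(1) coercive, of U] by blast
  define a where "a k = norm (e k - P (e k))" for k
  define b where "b k = norm (P (e k))" for k
  have e_le: "norm (e k) \<le> a k + b k" for k
    using norm_triangle_ineq[of "e k - P (e k)" "P (e k)"] by (simp add: a_def b_def)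
  have lim: "(\<lambda>k. \<mu> * r k ^ 2) \<longlonglongrightarrow> 0" "(\<lambda>k. \<mu> * \<beta> * r k ^ 3) \<longlonglongrightarrow> 0" "(\<lambda>k. \<beta> * r k) \<longlonglongrightarrow> 0"
    using r(2) by (auto intro!: tendsto_eq_intros)
  \<comment> \<open>Of the contraction constant \<open>c / 2\<close> of the gradient step,
    \<open>c / 4\<close> is given up to absorb the decay term acting on \<open>P (e k)\<close>,
    which leaves \<open>c / 4\<close> for the recursion of \<open>b\<close>.\<close>
  have small: "\<forall>\<^sub>F k in sequentially. \<mu> * r k ^ 2 < t0 \<and> \<mu> * \<beta> * r k ^ 3 < 1 \<and> \<beta> * r k < c / 4"
    using coercive t0 by (intro eventually_conj order_tendstoD(2)[OF lim(1)] order_tendstoD(2)[OF lim(2)]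
       order_tendstoD(2)[OF lim(3)]) auto
  have "\<exists>K. \<forall>k. a k + b k \<le> K * r k"
  proof (rule coupled_recursion_rate[where c = "c / 4" and L = L and F = "norm g"])
    show "\<forall>\<^sub>F k in sequentially. \<forall>B. (\<forall>j\<le>k. a j + b j \<le> B) \<longrightarrow>
      a (Suc k) \<le> (1 - \<mu> * \<beta> * r k ^ 3) * a k + \<mu> * r k ^ 2 * (C * r k ^ 2 * (B + norm g))"
      using d small
    proof (eventually_elim, intro allI impI)
      fix k B
      assume d: "\<forall>B. (\<forall>j\<le>k. norm (e j) \<le> B) \<longrightarrow> norm (d k) \<le> C * r k ^ 2 * (B + norm g)"
        and small: "\<mu> * r k ^ 2 < t0 \<and> \<mu> * \<beta> * r k ^ 3 < 1 \<and> \<beta> * r k < c / 4"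
        and "\<forall>j\<le>k. a j + b j \<le> B"
      then have dk: "norm (d k) \<le> C * r k ^ 2 * (B + norm g)"
        using e_le by (meson order_trans)
      have "e (Suc k) - P (e (Suc k)) =
          (1 - \<mu> * \<beta> * r k ^ 3) *\<^sub>R (e k - P (e k)) - (\<mu> * r k ^ 2) *\<^sub>R (d k - P (d k))"
        by (simp add: step linear_diff[OF P] linear_add[OF P] linear_scale[OF P] Pid[OF T(2)]
            Pid[OF U(2)] algebra_simps)
      then have "a (Suc k) \<le> \<bar>1 - \<mu> * \<beta> * r k ^ 3\<bar> * a k + \<bar>\<mu> * r k ^ 2\<bar> * norm (d k - P (d k))"
        unfolding a_def by (metis norm_triangle_ineq4 norm_scaleR)
      also have "\<dots> \<le> (1 - \<mu> * \<beta> * r k ^ 3) * a k + \<mu> * r k ^ 2 * (C * r k ^ 2 * (B + norm g))"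
        using small pos order_trans[OF Qle dk] by (intro add_mono mult_mono) (auto simp: a_def)
      finally show "a (Suc k) \<le> \<dots>" .
    qed
    show "\<forall>\<^sub>F k in sequentially. \<forall>B. (\<forall>j\<le>k. a j + b j \<le> B) \<longrightarrow>
      b (Suc k) \<le> (1 - c / 4 * \<mu> * r k ^ 2) * b k +
        \<mu> * r k ^ 2 * (\<beta> * r k * norm g + L * a k + C * r k ^ 2 * (B + norm g))"
      using d small
    proof (eventually_elim, intro allI impI)
      fix k B
      assume d: "\<forall>B. (\<forall>j\<le>k. norm (e j) \<le> B) \<longrightarrow> norm (d k) \<le> C * r k ^ 2 * (B + norm g)"
        and small: "\<mu> * r k ^ 2 < t0 \<and> \<mu> * \<beta> * r k ^ 3 < 1 \<and> \<beta> * r k < c / 4"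
        and "\<forall>j\<le>k. a j + b j \<le> B"
      then have dk: "norm (d k) \<le> C * r k ^ 2 * (B + norm g)"
        using e_le by (meson order_trans)
      let ?p = "P (e k)" and ?t = "\<mu> * r k ^ 2"
      let ?w = "(\<beta> * r k) *\<^sub>R g + T (e k - ?p) + P (d k)"
      have t: "0 \<le> ?t" "?t \<le> t0"
        using small pos by auto
      \<comment> \<open>Splitting \<open>T (e k)\<close> into \<open>T ?p\<close> and
        \<open>T (e k - ?p)\<close> separates the contracting part from the coupling to
        \<open>a\<close>.\<close>
      have "P (e (Suc k)) = (?p - ?t *\<^sub>R T ?p) - (?t * (\<beta> * r k)) *\<^sub>R ?p - ?t *\<^sub>R ?w"
        by (simp add: step linear_diff[OF P] linear_add[OF P] linear_scale[OF P] Pid[OF T(2)]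
            Pid[OF U(2)] linear_diff[OF T(1)] algebra_simps power2_eq_square power3_eq_cube)
      then have "b (Suc k) \<le> norm (?p - ?t *\<^sub>R T ?p) + norm ((?t * (\<beta> * r k)) *\<^sub>R ?p) + norm (?t *\<^sub>R ?w)"
        unfolding b_def by (simp only:) (intro norm_triangle_le_diff add_right_mono norm_triangle_ineq4)
      also have "norm (?p - ?t *\<^sub>R T ?p) \<le> (1 - c / 2 * ?t) * b k"
        using t0(2) t PU by (simp add: b_def)
      also have "norm ((?t * (\<beta> * r k)) *\<^sub>R ?p) \<le> ?t * (c / 4) * b k"
        using small pos coercive(1) r(1)[of k] unfolding norm_scaleR b_def abs_mult
        by (intro mult_mono) auto
      also have "norm (?t *\<^sub>R ?w) \<le> ?t * (\<beta> * r k * norm g + L * a k + C * r k ^ 2 * (B + norm g))"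
      proof -
        have "norm ?w \<le> norm ((\<beta> * r k) *\<^sub>R g) + norm (T (e k - ?p)) + norm (P (d k))"
          by (intro norm_triangle_le add_right_mono norm_triangle_ineq)
        also have "\<dots> \<le> \<beta> * r k * norm g + L * a k + C * r k ^ 2 * (B + norm g)"
          using L(2)[of "e k - ?p"] order_trans[OF Ple dk] pos r(1)[of k]
          by (intro add_mono) (auto simp: a_def)
        finally show ?thesis
          using t by (simp add: mult_left_mono)
      qed
      finally show "b (Suc k) \<le> (1 - c / 4 * \<mu> * r k ^ 2) * b k +
        \<mu> * r k ^ 2 * (\<beta> * r k * norm g + L * a k + C * r k ^ 2 * (B + norm g))"
        by (simp add: algebra_simps)
    qed
  qed (use r slow pos coercive C L in \<open>auto simp: a_def b_def\<close>)
  then show ?thesis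
    using e_le by (meson order_trans)
qed

section \<open>The stepsize scale and the drift over a delay\<close>

text \<open>The relative decrease in one step is of order \<open>1 / k\<close>, which is eventually
  below any multiple of \<open>k powr (-3/4)\<close>.\<close>

lemma inv_root4_slowly_varying:
  assumes "0 < s"
  shows "\<forall>\<^sub>F k in sequentially. (1 - s * (1 / root 4 (real (Suc k))) ^ 3) * (1 / root 4 (real (Suc k)))
    \<le> 1 / root 4 (real (Suc (Suc k)))"
proof -
  have root: "1 / root 4 (real (Suc k)) = (real k + 1) powr (-1/4)" for k
    by (simp add: root_powr_inverse powr_minus_divide add.commute)
  have cube: "((real k + 1) powr (-1/4)) ^ 3 = (real k + 1) powr (-3/4)" for k
    by (simp add: powr_power)
  have "\<forall>\<^sub>F k in sequentially. (1 - s * (real k + 1) powr (-3/4)) * (real k + 1) powr (-1/4)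
      \<le> (real (Suc k) + 1) powr (-1/4)"
    using assms by real_asymp
  then show ?thesis
    by (simp only: root cube)
qed

lemma inv_root4_le_twice:
  "1 / root 4 (real (Suc k)) \<le> 2 * (1 / root 4 (real (Suc (Suc k))))"
proof -
  have "root 4 (real (Suc (Suc k))) \<le> root 4 (2 ^ 4 * real (Suc k))"
    by (intro real_root_le_mono) auto
  also have "\<dots> = 2 * root 4 (real (Suc k))"
    by (subst real_root_mult) (subst real_root_power_cancel, auto)
  finally show ?thesis
    by (simp add: field_simps)
qed

text \<open>Each increment is measured at its own time, but the bound is wanted at the end of the
  window. Going back one step at most doubles \<open>r\<close>, so each of the \<open>n\<close>
  squares costs at most a factor \<open>4 ^ n\<close>.\<close>

lemma drift_le:
  fixes e :: "nat \<Rightarrow> 'a::real_normed_vector" and r :: "nat \<Rightarrow> real"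
  assumes r: "\<And>i. 0 \<le> r i" "\<And>i. r i \<le> 2 * r (Suc i)" and "0 \<le> D"
    and step: "\<And>i. i < j + n \<Longrightarrow> norm (e (Suc i) - e i) \<le> r i ^ 2 * D"
  shows "norm (e j - e (j + n)) \<le> real n * 4 ^ n * (r (j + n) ^ 2 * D)"
  using step
proof (induction n)
  case (Suc n)
  have "norm (e j - e (j + Suc n)) \<le> norm (e j - e (j + n)) + norm (e (Suc (j + n)) - e (j + n))"
    using norm_triangle_ineq4[of "e j - e (j + n)" "e (Suc (j + n)) - e (j + n)"] by simp
  also have "\<dots> \<le> real n * 4 ^ n * (r (j + n) ^ 2 * D) + 4 ^ n * (r (j + n) ^ 2 * D)"
  proof (rule add_mono)
    have "1 * (r (j + n) ^ 2 * D) \<le> 4 ^ n * (r (j + n) ^ 2 * D)"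
      using \<open>0 \<le> D\<close> by (intro mult_right_mono) auto
    then show "norm (e (Suc (j + n)) - e (j + n)) \<le> 4 ^ n * (r (j + n) ^ 2 * D)"
      using Suc.prems[of "j + n"] by simp
  qed (use Suc in simp)
  also have "\<dots> = real (Suc n) * 4 ^ n * (r (j + n) ^ 2 * D)"
    by (simp add: algebra_simps)
  also have "\<dots> \<le> real (Suc n) * 4 ^ n * ((2 * r (Suc (j + n))) ^ 2 * D)"
    using r \<open>0 \<le> D\<close> by (intro mult_left_mono mult_right_mono power_mono) auto
  also have "\<dots> = real (Suc n) * 4 ^ Suc n * (r (j + Suc n) ^ 2 * D)"
    by (simp add: power_mult_distrib)
  finally show ?case .
qed simp

text \<open>The weights depend on \<open>v\<close> as well as on \<open>u\<close>, as delays do, so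
  the vector need not be a combination of the \<open>g u\<close>; the estimate is made entry by
  entry.\<close>

lemma norm_weighted_sum_le:
  fixes g :: "'n::finite \<Rightarrow> real ^ 'n"
  assumes "\<And>u v. \<bar>y u v\<bar> \<le> Y"
  shows "norm (\<chi> v. \<Sum>u\<in>S. y u v * g u $ v) \<le> (\<Sum>v\<in>UNIV. \<Sum>u\<in>S. \<bar>g u $ v\<bar>) * Y"
proof -
  have "norm (\<chi> v. \<Sum>u\<in>S. y u v * g u $ v) \<le> (\<Sum>v\<in>UNIV. \<bar>\<Sum>u\<in>S. y u v * g u $ v\<bar>)"
    using norm_le_l1_cart[of "\<chi> v. \<Sum>u\<in>S. y u v * g u $ v"] by simp
  also have "\<dots> \<le> (\<Sum>v\<in>UNIV. \<Sum>u\<in>S. \<bar>g u $ v\<bar> * Y)"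
  proof (rule sum_mono)
    fix v
    have "\<bar>\<Sum>u\<in>S. y u v * g u $ v\<bar> \<le> (\<Sum>u\<in>S. \<bar>y u v * g u $ v\<bar>)"
      by (rule sum_abs)
    also have "\<dots> \<le> (\<Sum>u\<in>S. \<bar>g u $ v\<bar> * Y)"
      using assms by (intro sum_mono) (simp add: abs_mult mult.commute mult_right_mono)
    finally show "\<bar>\<Sum>u\<in>S. y u v * g u $ v\<bar> \<le> (\<Sum>u\<in>S. \<bar>g u $ v\<bar> * Y)" .
  qed
  finally show ?thesis
    by (simp add: sum_distrib_right)
qed

section \<open>The sampling operator\<close>

text \<open>For \<open>x\<close> in \<open>U\<close> the projected indicators reproduce the samples,
  so the inner product is the sum of the squared samples on \<open>S\<close>. Restriction to
  \<open>S\<close> is injective on \<open>U\<close> by uniqueness, hence bounded below in finite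
  dimension.\<close>

lemma sampling_operator_coercive:
  fixes U :: "(real ^ 'n::finite) set"
  assumes U: "subspace U" and S: "uniqueness_set S U"
  shows "\<exists>c>0. \<forall>x\<in>U. c * norm x ^ 2 \<le>
    inner x (\<Sum>u\<in>S. x $ u *\<^sub>R orthogonal_projection U (axis u 1))"
proof -
  define R :: "real ^ 'n \<Rightarrow> real ^ 'n" where "R x = (\<chi> u. if u \<in> S then x $ u else 0)" for x
  have "linear R"
    by (rule linearI) (auto simp: R_def vec_eq_iff)
  moreover have "x = 0" if "x \<in> U" "R x = 0" for x
  proof -
    have "x $ v = 0 $ v" if "v \<in> S" for v
      using \<open>R x = 0\<close> that by (auto simp: R_def vec_eq_iff split: if_splits)
    then show ?thesis
      using S \<open>x \<in> U\<close> subspace_0[OF U] unfolding uniqueness_set_def by blast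
  qed
  ultimately obtain c where c: "0 < c" "\<forall>x\<in>U. c * norm x \<le> norm (R x)"
    using injective_imp_isometric[OF closed_subspace[OF U] U, of R]
    by (auto simp: linear_conv_bounded_linear)
  have "c^2 * norm x ^ 2 \<le> inner x (\<Sum>u\<in>S. x $ u *\<^sub>R orthogonal_projection U (axis u 1))"
    if x: "x \<in> U" for x
  proof -
    have "inner (orthogonal_projection U (axis u 1)) x = x $ u" for u
      using orthogonal_projection(2)[OF U x, of "axis u 1"]
      by (simp add: orthogonal_def inner_diff_left inner_axis')
    then have "inner x (\<Sum>u\<in>S. x $ u *\<^sub>R orthogonal_projection U (axis u 1)) = (\<Sum>u\<in>S. x $ u * x $ u)"
      by (simp add: inner_sum_right inner_commute[of x])
    also have "\<dots> = (\<Sum>u\<in>UNIV. if u \<in> S then x $ u * x $ u else 0)"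
      by (simp add: sum.If_cases)
    also have "\<dots> = norm (R x) ^ 2"
      unfolding power2_norm_eq_inner inner_vec_def R_def by (intro sum.cong) auto
    finally show ?thesis
      using c x power_mono[of "c * norm x" "norm (R x)" 2] by (simp add: power_mult_distrib)
  qed
  with c(1) show ?thesis
    by (intro exI[of _ "c^2"]) auto
qed

section \<open>Convergence of the DLSR iterates\<close>

theorem proposition3:
  fixes G :: "('n::finite, 'e) pre_digraph"
    and \<omega> \<mu>1 \<beta>1 :: real
    and S :: "'n set"
    and \<tau> :: "'n \<Rightarrow> 'n \<Rightarrow> nat"
    and \<mu> \<beta> :: "nat \<Rightarrow> real"
    and fs :: "real ^ 'n"
    and f :: "nat \<Rightarrow> real ^ 'n"
  assumes "graph G" and "verts G = UNIV" and "Digraph_Component.connected G"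
    and "\<omega> \<ge> 0"
    and "fs \<in> paley_wiener G \<omega>"
    and "uniqueness_set S (paley_wiener G \<omega>)"
    and "\<And>u. u \<in> S \<Longrightarrow> \<tau> u u = 0"
    and "\<mu>1 > 0" and "\<beta>1 > 0"
    and "\<And>k. k \<ge> 1 \<Longrightarrow> \<mu> k = \<mu>1 / sqrt (real k)"
    and "\<And>k. k \<ge> 1 \<Longrightarrow> \<beta> k = \<beta>1 / root 4 (real k)"
    and "f = dlsr G \<omega> S \<tau> \<mu> \<beta> fs"
  shows "(\<exists>K. \<forall>k\<ge>1. norm (f k - fs) \<le> K / root 4 (real k)) \<and>
         (\<lambda>k. norm (f k - fs)) \<longlonglongrightarrow> 0"
proof -
  define U where "U = paley_wiener G \<omega>"
  have U: "subspace U"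
    by (simp add: U_def paley_wiener_def subspace_span)
  define g where "g u = orthogonal_projection U (axis u 1)" for u
  define T where "T x = (\<Sum>u\<in>S. x $ u *\<^sub>R g u)" for x
  \<comment> \<open>The shift matches the update from \<open>k\<close> to \<open>Suc k\<close>,
    which uses the stepsize with index \<open>Suc k\<close>.\<close>
  define r where "r k = 1 / root 4 (real (Suc k))" for k
  define e where "e k = f k - fs" for k
  define p where "p k u v = (if \<tau> u v \<le> k then e (k - \<tau> u v) $ u else 0)" for k u v
  define h where "h k = (\<chi> v. \<Sum>u\<in>S. p k u v * g u $ v)" for k
  \<comment> \<open>If all delays were zero, \<open>h k\<close> would equal \<open>T (e k)\<close>;
    thus \<open>d\<close> isolates their effect.\<close>
  define d where "d k = h k - T (e k)" for k
  define N where "N = (\<Sum>v\<in>UNIV. \<Sum>u\<in>S. \<bar>g u $ v\<bar>)"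
  define M where "M = \<mu>1 * (\<beta>1 + N)"
  define m where "m = Max (range (case_prod \<tau>))"
  have N: "0 \<le> N"
    by (simp add: N_def sum_nonneg)
  have M: "0 \<le> M"
    using N assms by (simp add: M_def)
  have \<tau>: "\<tau> u v \<le> m" for u v
    unfolding m_def by (rule Max_ge) (auto intro!: image_eqI[of _ _ "(u, v)"])
  have r: "0 < r k" "r k \<le> 1" "r k \<le> 2 * r (Suc k)" for k
    unfolding r_def by (simp, simp add: real_root_ge_1_iff, rule inv_root4_le_twice)
  have rlim: "r \<longlonglongrightarrow> 0"
    unfolding r_def by real_asymp
  have \<mu>: "\<mu> (Suc k) = \<mu>1 * r k ^ 2" for k
    using assms(10)[of "Suc k"] real_root_mult_exp[of 2 2 "real (Suc k)"]
    by (simp add: r_def power_divide sqrt_def)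
  have \<beta>: "\<beta> (Suc k) = \<beta>1 * r k" for k
    using assms(11)[of "Suc k"] by (simp add: r_def)
  have f_Suc: "f (Suc k) = (1 - \<mu>1 * \<beta>1 * r k ^ 3) *\<^sub>R f k - (\<mu>1 * r k ^ 2) *\<^sub>R h k" for k
  proof -
    have "(if \<tau> u v \<le> k then fs $ u - f (k - \<tau> u v) $ u else 0) = - p k u v" for u v
      by (simp add: p_def e_def)
    then show ?thesis
      unfolding assms(12) dlsr.simps unfolding assms(12)[symmetric] \<mu> \<beta>
      by (simp add: vec_eq_iff h_def g_def U_def sum_negf power2_eq_square power3_eq_cube)
  qed
  \<comment> \<open>The decay pulls the iterate towards zero instead of \<open>fs\<close>, which
    leaves the forcing term in \<open>fs\<close>.\<close>
  have e_Suc: "e (Suc k) = (1 - \<mu>1 * \<beta>1 * r k ^ 3) *\<^sub>R e k - (\<mu>1 * \<beta>1 * r k ^ 3) *\<^sub>R fs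
      - (\<mu>1 * r k ^ 2) *\<^sub>R (T (e k) + d k)" for k
    by (simp add: e_def f_Suc d_def algebra_simps)
  \<comment> \<open>Both the decay and the sampling sum carry the stepsize, and
    \<open>r i \<le> 1\<close>; \<open>M\<close> collects their constants.\<close>
  have e_step: "norm (e (Suc i) - e i) \<le> r i ^ 2 * (M * (B + norm fs))"
    if B: "\<forall>j\<le>i. norm (e j) \<le> B" for i B
  proof -
    have B0: "0 \<le> B"
      using B norm_ge_zero order_trans by blast
    have "\<bar>p i u v\<bar> \<le> B" for u v
      using B B0 order_trans[OF component_le_norm_cart[of "e (i - \<tau> u v)" u], of B]
      by (simp add: p_def)
    then have "norm (h i) \<le> N * B"
      unfolding h_def N_def by (rule norm_weighted_sum_le)
    moreover have "norm (f i) \<le> B + norm fs"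
      using B[rule_format, of i] norm_triangle_ineq[of "e i" fs] by (simp add: e_def)
    moreover have "\<beta>1 * r i \<le> \<beta>1"
      using assms(9) r(1,2)[of i] by simp
    ultimately have sum_le: "\<beta>1 * r i * norm (f i) + norm (h i) \<le> \<beta>1 * (B + norm fs) + N * (B + norm fs)"
      using assms(9) r(1)[of i] N B0
      by (intro add_mono mult_mono) (auto intro: order_trans[OF _ mult_left_mono])
    have "e (Suc i) - e i = - ((\<mu>1 * r i ^ 2) *\<^sub>R ((\<beta>1 * r i) *\<^sub>R f i + h i))"
      by (simp add: e_def f_Suc algebra_simps power2_eq_square power3_eq_cube)
    then have "norm (e (Suc i) - e i) = \<mu>1 * r i ^ 2 * norm ((\<beta>1 * r i) *\<^sub>R f i + h i)"
      using assms(8) by simp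
    also have "\<dots> \<le> \<mu>1 * r i ^ 2 * (\<beta>1 * r i * norm (f i) + norm (h i))"
      using assms(8,9) r(1)[of i] norm_triangle_ineq[of "(\<beta>1 * r i) *\<^sub>R f i" "h i"]
      by (intro mult_left_mono) auto
    also have "\<dots> \<le> \<mu>1 * r i ^ 2 * (\<beta>1 * (B + norm fs) + N * (B + norm fs))"
      using assms(8) by (intro mult_left_mono sum_le) simp
    finally show ?thesis
      by (simp add: M_def algebra_simps)
  qed
  \<comment> \<open>From time \<open>m\<close> on no delayed time is negative, so \<open>d k\<close>
    consists only of drifts of \<open>e\<close> over at most \<open>m\<close> steps.\<close>
  have d_bound: "norm (d k) \<le> N * (real m * 4 ^ m * M) * r k ^ 2 * (B + norm fs)"
    if k: "m \<le> k" and B: "\<forall>j\<le>k. norm (e j) \<le> B" for k B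
  proof -
    let ?D = "M * (B + norm fs)"
    have "0 \<le> B"
      using B norm_ge_zero order_trans by blast
    then have D: "0 \<le> ?D"
      using M by simp
    have "\<bar>p k u v - e k $ u\<bar> \<le> real m * 4 ^ m * (r k ^ 2 * ?D)" for u v
    proof -
      have k': "\<tau> u v \<le> k"
        using \<tau> k order_trans by blast
      have "\<bar>p k u v - e k $ u\<bar> \<le> norm (e (k - \<tau> u v) - e k)"
        using k' component_le_norm_cart[of "e (k - \<tau> u v) - e k" u] by (simp add: p_def)
      also have "\<dots> \<le> real (\<tau> u v) * 4 ^ \<tau> u v * (r k ^ 2 * ?D)"
        using drift_le[of r ?D "k - \<tau> u v" "\<tau> u v" e] r D e_step B k'
        by (simp add: less_imp_le)
      also have "\<dots> \<le> real m * 4 ^ m * (r k ^ 2 * ?D)"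
        using \<tau> D by (intro mult_right_mono mult_mono power_increasing) auto
      finally show ?thesis .
    qed
    moreover have "d k = (\<chi> v. \<Sum>u\<in>S. (p k u v - e k $ u) * g u $ v)"
      by (simp add: vec_eq_iff d_def h_def T_def sum_subtractf algebra_simps)
    ultimately have "norm (d k) \<le> N * (real m * 4 ^ m * (r k ^ 2 * ?D))"
      unfolding N_def by (simp only:) (rule norm_weighted_sum_le)
    then show ?thesis
      by (simp add: algebra_simps)
  qed
  obtain c where c: "0 < c" "\<And>x. x \<in> U \<Longrightarrow> c * norm x ^ 2 \<le> inner x (T x)"
    using sampling_operator_coercive[OF U] assms(6) unfolding T_def g_def U_def by blast
  have "\<exists>K. \<forall>k. norm (e k) \<le> K * r k"
  proof (rule perturbed_coercive_iteration_rate[OF U _ _ _ c _ rlim _ assms(8,9) e_Suc])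
    show "linear T"
      by (rule linearI) (auto simp: T_def sum.distrib scaleR_sum_right algebra_simps)
    show "T x \<in> U" for x
      unfolding T_def g_def using U orthogonal_projection(1)
      by (intro subspace_sum subspace_scale) auto
    show "\<forall>\<^sub>F k in sequentially. (1 - s * r k ^ 3) * r k \<le> r (Suc k)" if "0 < s" for s
      using inv_root4_slowly_varying[OF that] by (simp only: r_def)
    show "\<forall>\<^sub>F k in sequentially. \<forall>B. (\<forall>j\<le>k. norm (e j) \<le> B) \<longrightarrow>
        norm (d k) \<le> N * (real m * 4 ^ m * M) * r k ^ 2 * (B + norm fs)"
      using eventually_ge_at_top[of m] by eventually_elim (use d_bound in blast)
  qed (use assms(5) r N M in \<open>auto simp: U_def\<close>)
  then obtain K where K: "\<And>k. norm (e k) \<le> K * r k"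
    by blast
  have "norm (f k - fs) \<le> K / root 4 (real k)" if "k \<ge> 1" for k
  proof -
    \<comment> \<open>The rate was obtained with \<open>Suc k\<close> under the root; weakening it
      to \<open>k\<close> needs the sign of \<open>K\<close>.\<close>
    have "0 \<le> K"
      using order_trans[OF norm_ge_zero K[of 0]] by (simp add: r_def)
    have "norm (f k - fs) \<le> K / root 4 (real (Suc k))"
      using K[of k] by (simp add: e_def r_def)
    also have "\<dots> \<le> K / root 4 (real k)"
      using \<open>0 \<le> K\<close> that by (intro divide_left_mono mult_pos_pos real_root_le_mono) auto
    finally show ?thesis .
  qed
  moreover have "(\<lambda>k. norm (f k - fs)) \<longlonglongrightarrow> 0"
  proof (rule tendsto_sandwich[where f = "\<lambda>_. 0"])
    show "(\<lambda>k. K * r k) \<longlonglongrightarrow> 0"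
      using rlim by (auto intro!: tendsto_eq_intros)
    show "\<forall>\<^sub>F k in sequentially. norm (f k - fs) \<le> K * r k"
      using K by (simp add: e_def)
  qed auto
  ultimately show ?thesis
    by blast
qed

end
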